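(* Let $n\ge 1$ and let $A$ be an $n\times n$ complex matrix. Then, as a linear map $V\to V$, $$\mathrm{ptr}\Big(\mathrm{Alt}_{n+1}\circ\big(\mathrm{id}_V\otimes A^{\otimes n}\big)\Big)=0 .$$
   Context: $V=\mathbb{C}^n$. For $m\ge 0$, the anti-symmetrizer $\mathrm{Alt}_m:V^{\otimes m}\to V^{\otimes m}$ is the (unnormalized) linear map $a_1\otimes\cdots\otimes a_m\mapsto \sum_{\sigma\in\Sigma_m}\mathrm{sgn}(\sigma)\,a_{\sigma(1)}\otimes\cdots\otimes a_{\sigma(m)}$, where $\Sigma_m$ is the symmetric group on $m$ letters. For a linear map $F:V^{\otimes(k+1)}\to V^{\otimes(k+1)}$, $\mathrm{ptr}(F):V\to V$ denotes the partial trace over the last $k$ tensor factors, i.e. the map obtained by closing up the last $k$ strands of the diagram of $F$ into loops and leaving the first strand open. The diagram in question has an anti-symmetrizer on $n+1$ strands, with the first strand open and unlabelled and each of the other $n$ strands labelled by $A$ and closed up. *)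

theory Defs
  imports "HOL-Analysis.Analysis"
begin

text \<open>
  Here \<open>V\<close> is \<open>complex ^ 'n\<close>, of dimension \<open>n = CARD('n)\<close>. A tensor in the \<open>m\<close>-th tensor power
  of \<open>V\<close> is represented by its coordinates with respect to the standard basis, i.e. by a function
  of type \<open>'n list \<Rightarrow> complex\<close> that vanishes on every multi-index whose length is not \<open>m\<close>.
  Strands and tensor factors are numbered from 0.
\<close>

type_synonym 'n tensor = "'n list \<Rightarrow> complex"

definition tensor_power :: "nat \<Rightarrow> 'n tensor set" where
  "tensor_power m = {t. \<forall>J. length J \<noteq> m \<longrightarrow> t J = 0}"

definition pure_tensor :: "(complex ^ 'n) list \<Rightarrow> 'n tensor" where
  "pure_tensor as J =
     (if length J = length as then \<Prod>j<length as. (as ! j) $ (J ! j) else 0)"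

definition std_basis :: "'n list \<Rightarrow> (complex ^ 'n) list" where
  "std_basis I = map (\<lambda>i. axis i 1) I"

text \<open>
  \<open>lin_ext m f\<close> is the linear map on the \<open>m\<close>-th tensor power that sends the basis tensor with
  multi-index \<open>I\<close> to \<open>f I\<close>.
\<close>

definition lin_ext :: "nat \<Rightarrow> ('n::finite list \<Rightarrow> 'n tensor) \<Rightarrow> 'n tensor \<Rightarrow> 'n tensor" where
  "lin_ext m f t J = (\<Sum>I | length I = m. t I * f I J)"

text \<open>
  \<open>Alt_on as\<close> is the value prescribed for the anti-symmetrizer on the pure tensor of the vectors
  \<open>as\<close>; lemma \<open>Alt_pure_tensor\<close> below shows that prescribing it on basis tensors gives it on all
  pure tensors.
\<close>

definition Alt_on :: "(complex ^ 'n) list \<Rightarrow> 'n tensor" where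
  "Alt_on as J =
     (\<Sum>\<sigma> | \<sigma> permutes {..<length as}.
        of_int (sign \<sigma>) * pure_tensor (map (\<lambda>j. as ! \<sigma> j) [0..<length as]) J)"

definition Alt :: "nat \<Rightarrow> 'n::finite tensor \<Rightarrow> 'n tensor" where
  "Alt m = lin_ext m (\<lambda>I. Alt_on (std_basis I))"

text \<open>The tensor product of a list of linear maps \<open>V \<rightarrow> V\<close>.\<close>

definition tensor_map ::
    "(complex ^ 'n \<Rightarrow> complex ^ 'n) list \<Rightarrow> 'n::finite tensor \<Rightarrow> 'n tensor" where
  "tensor_map fs =
     lin_ext (length fs) (\<lambda>I. pure_tensor (map2 (\<lambda>f a. f a) fs (std_basis I)))"

text \<open>
  The partial trace over the last \<open>k\<close> of \<open>k + 1\<close> tensor factors: the output indices of these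
  factors are set equal to their input indices and summed over.
\<close>

definition ptr ::
    "nat \<Rightarrow> ('n::finite tensor \<Rightarrow> 'n tensor) \<Rightarrow> complex ^ 'n \<Rightarrow> complex ^ 'n" where
  "ptr k F v =
     (\<chi> i. \<Sum>J | length J = k. F (pure_tensor (v # std_basis J)) (i # J))"

lemma length_std_basis [simp]: "length (std_basis I) = length I"
  by (simp add: std_basis_def)

lemma finite_multi_indices [simp]: "finite {I :: 'n::finite list. length I = m}"
  using finite_lists_length_eq[of "UNIV :: 'n set" m] by simp

lemma sum_prod_multi_indices:
  fixes g :: "nat \<Rightarrow> 'n::finite \<Rightarrow> complex"
  shows "(\<Sum>I | length I = m. \<Prod>j<m. g j (I ! j)) = (\<Prod>j<m. \<Sum>i\<in>UNIV. g j i)"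
proof (induction m arbitrary: g)
  case 0
  then show ?case by simp
next
  case (Suc m)
  have "(\<Sum>I | length I = Suc m. \<Prod>j<Suc m. g j (I ! j)) =
      (\<Sum>(i, I)\<in>UNIV \<times> {I. length I = m}. \<Prod>j<Suc m. g j ((i # I) ! j))"
    by (rule sum.reindex_bij_witness[of _ "\<lambda>(i, I). i # I" "\<lambda>I. (hd I, tl I)"])
       (auto simp: length_Suc_conv)
  also have "\<dots> = (\<Sum>i\<in>UNIV. \<Sum>I | length I = m. g 0 i * (\<Prod>j<m. g (Suc j) (I ! j)))"
    by (subst sum.cartesian_product [symmetric])
       (simp add: prod.lessThan_Suc_shift del: prod.lessThan_Suc)
  also have "\<dots> = (\<Sum>i\<in>UNIV. g 0 i) * (\<Prod>j<m. \<Sum>i\<in>UNIV. g (Suc j) i)"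
    by (simp add: Suc.IH[of "\<lambda>j. g (Suc j)"] flip: sum_distrib_left sum_distrib_right)
  finally show ?case
    by (simp add: prod.lessThan_Suc_shift del: prod.lessThan_Suc)
qed

lemma pure_std_basis:
  "pure_tensor (std_basis I) J = (if J = I then 1 else 0)"
proof (cases "length J = length I")
  case True
  have "(\<Prod>j<length I. std_basis I ! j $ (J ! j)) =
      (\<Prod>j<length I. if J ! j = I ! j then 1 else 0)"
    by (intro prod.cong) (auto simp: std_basis_def axis_def)
  also have "\<dots> = (if J = I then 1 else 0)"
    using True by (auto simp: list_eq_iff_nth_eq prod_zero_iff)
  finally show ?thesis
    using True by (simp add: pure_tensor_def)
qed (auto simp: pure_tensor_def)

lemma lin_ext_std_basis:
  assumes "length I = m"
  shows "lin_ext m f (pure_tensor (std_basis I)) = f I"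
proof
  fix J
  have "lin_ext m f (pure_tensor (std_basis I)) J =
      (\<Sum>K | length K = m. if K = I then f K J else 0)"
    unfolding lin_ext_def by (intro sum.cong) (auto simp: pure_std_basis)
  then show "lin_ext m f (pure_tensor (std_basis I)) J = f I J"
    using assms by simp
qed

lemma basis_expansion_tensor:
  assumes "t \<in> tensor_power m"
  shows "lin_ext m (\<lambda>I. pure_tensor (std_basis I)) t = t"
proof
  fix J
  have "lin_ext m (\<lambda>I. pure_tensor (std_basis I)) t J =
      (\<Sum>I | length I = m. if I = J then t I else 0)"
    unfolding lin_ext_def by (intro sum.cong) (auto simp: pure_std_basis)
  then show "lin_ext m (\<lambda>I. pure_tensor (std_basis I)) t J = t J"
    using assms by (simp add: tensor_power_def)
qed

lemma Alt_pure_tensor: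
  fixes as :: "(complex ^ 'n::finite) list"
  assumes "length as = m"
  shows "Alt m (pure_tensor as) = Alt_on as"
proof
  fix J :: "'n list"
  show "Alt m (pure_tensor as) J = Alt_on as J"
  proof (cases "length J = m")
    case False
    then show ?thesis
      using assms by (simp add: Alt_def lin_ext_def Alt_on_def pure_tensor_def)
  next
    case True
    have key: "(\<Sum>I | length I = m. (\<Prod>j<m. as ! j $ (I ! j)) *
          pure_tensor (map (\<lambda>j. std_basis I ! \<sigma> j) [0..<m]) J) =
        pure_tensor (map (\<lambda>j. as ! \<sigma> j) [0..<m]) J"
      if \<sigma>: "\<sigma> permutes {..<m}" for \<sigma>
    proof -
      have \<sigma>_lt: "\<sigma> j < m" if "j < m" for j
        using permutes_in_image[OF \<sigma>, of j] that by simp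
      have inv_\<sigma>: "inv \<sigma> (\<sigma> j) = j" for j
        using \<sigma> by (simp add: permutes_inverses)
      have "pure_tensor (map (\<lambda>j. std_basis I ! \<sigma> j) [0..<m]) J =
          (\<Prod>j<m. if I ! j = J ! inv \<sigma> j then 1 else 0)" if "length I = m" for I
      proof -
        have "pure_tensor (map (\<lambda>j. std_basis I ! \<sigma> j) [0..<m]) J =
            (\<Prod>j<m. if I ! \<sigma> j = J ! inv \<sigma> (\<sigma> j) then 1 else 0)"
          using True that
          by (auto simp: pure_tensor_def std_basis_def axis_def inv_\<sigma> \<sigma>_lt intro!: prod.cong)
        also have "\<dots> = (\<Prod>j<m. if I ! j = J ! inv \<sigma> j then 1 else 0)"
          using prod.permute[OF \<sigma>, of "\<lambda>j. if I ! j = J ! inv \<sigma> j then 1 else (0::complex)"]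
          by (simp add: comp_def)
        finally show ?thesis .
      qed
      then have "(\<Sum>I | length I = m. (\<Prod>j<m. as ! j $ (I ! j)) *
          pure_tensor (map (\<lambda>j. std_basis I ! \<sigma> j) [0..<m]) J) =
          (\<Sum>I | length I = m. \<Prod>j<m. as ! j $ (I ! j) *
             (if I ! j = J ! inv \<sigma> j then 1 else 0))"
        by (intro sum.cong) (simp_all add: prod.distrib)
      also have "\<dots> = (\<Prod>j<m. \<Sum>i\<in>UNIV. as ! j $ i * (if i = J ! inv \<sigma> j then 1 else 0))"
        by (rule sum_prod_multi_indices)
      also have "\<dots> = (\<Prod>j<m. as ! j $ (J ! inv \<sigma> j))"
        by (simp add: if_distrib cong: if_cong)
      also have "\<dots> = (\<Prod>j<m. as ! \<sigma> j $ (J ! j))"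
        using prod.permute[OF \<sigma>, of "\<lambda>j. as ! j $ (J ! inv \<sigma> j)"]
        by (simp add: comp_def inv_\<sigma>)
      finally show ?thesis
        using True by (simp add: pure_tensor_def)
    qed
    have "Alt m (pure_tensor as) J =
        (\<Sum>I | length I = m. \<Sum>\<sigma> | \<sigma> permutes {..<m}. of_int (sign \<sigma>) *
           ((\<Prod>j<m. as ! j $ (I ! j)) *
              pure_tensor (map (\<lambda>j. std_basis I ! \<sigma> j) [0..<m]) J))"
      unfolding Alt_def lin_ext_def
      by (intro sum.cong)
         (simp_all add: Alt_on_def pure_tensor_def[of as] assms sum_distrib_left mult_ac)
    also have "\<dots> = (\<Sum>\<sigma> | \<sigma> permutes {..<m}. of_int (sign \<sigma>) *
        pure_tensor (map (\<lambda>j. as ! \<sigma> j) [0..<m]) J)"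
      by (subst sum.swap) (simp add: key flip: sum_distrib_left)
    finally show ?thesis
      using assms by (simp add: Alt_on_def)
  qed
qed

lemma tensor_map_pure_tensor:
  fixes as :: "(complex ^ 'n::finite) list"
  assumes len: "length as = length fs"
    and lin: "\<And>f. f \<in> set fs \<Longrightarrow> Vector_Spaces.linear (*s) (*s) f"
  shows "tensor_map fs (pure_tensor as) = pure_tensor (map2 (\<lambda>f a. f a) fs as)"
proof
  fix J :: "'n list"
  let ?m = "length fs"
  show "tensor_map fs (pure_tensor as) J = pure_tensor (map2 (\<lambda>f a. f a) fs as) J"
  proof (cases "length J = ?m")
    case False
    then show ?thesis
      using len by (simp add: tensor_map_def lin_ext_def pure_tensor_def)
  next
    case True
    have expand: "(\<Sum>i\<in>UNIV. as ! j $ i * (fs ! j) (axis i 1) $ (J ! j)) =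
        (fs ! j) (as ! j) $ (J ! j)" if "j < ?m" for j
      using arg_cong[OF matrix_works[OF lin[of "fs ! j"], of "as ! j"], of "\<lambda>x. x $ (J ! j)"] that
      by (simp add: matrix_def matrix_vector_mult_def mult.commute)
    have "tensor_map fs (pure_tensor as) J =
        (\<Sum>I | length I = ?m. \<Prod>j<?m. as ! j $ (I ! j) * (fs ! j) (axis (I ! j) 1) $ (J ! j))"
      unfolding tensor_map_def lin_ext_def using True len
      by (intro sum.cong) (simp_all add: pure_tensor_def std_basis_def prod.distrib)
    also have "\<dots> = (\<Prod>j<?m. \<Sum>i\<in>UNIV. as ! j $ i * (fs ! j) (axis i 1) $ (J ! j))"
      by (rule sum_prod_multi_indices)
    also have "\<dots> = pure_tensor (map2 (\<lambda>f a. f a) fs as) J"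
      using True len by (simp add: pure_tensor_def expand)
    finally show ?thesis .
  qed
qed

lemma ptr_tensor_map:
  fixes Bs :: "(complex ^ 'n::finite ^ 'n) list"
  assumes "Vector_Spaces.linear (*s) (*s) f"
  shows "ptr (length Bs) (tensor_map (f # map (*v) Bs)) v =
    (\<Prod>j<length Bs. trace (Bs ! j)) *s f v"
proof -
  let ?k = "length Bs"
  have lin: "Vector_Spaces.linear (*s) (*s) g" if "g \<in> set (f # map (*v) Bs)" for g
    using that assms by auto
  have "tensor_map (f # map (*v) Bs) (pure_tensor (v # std_basis J)) (i # J) =
      f v $ i * (\<Prod>j<?k. (Bs ! j) $ (J ! j) $ (J ! j))" if "length J = ?k" for i J
    using that
    by (subst tensor_map_pure_tensor)
       (auto simp: lin pure_tensor_def std_basis_def prod.lessThan_Suc_shift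
          matrix_vector_mult_def axis_def if_distrib cong: if_cong simp del: prod.lessThan_Suc
          intro!: prod.cong assms)
  then show ?thesis
    by (simp add: ptr_def vec_eq_iff trace_def sum_prod_multi_indices[where m = ?k and g = "\<lambda>j i. Bs ! j $ i $ i"]
        flip: sum_distrib_left)
qed

end

theory Submission
  imports Defs
begin

text \<open>
  A multi-index of length \<open>m > n\<close> repeats some entry; exchanging the two equal positions pairs off
  the terms of the anti-symmetrizer with opposite signs. Hence \<open>Alt m = 0\<close> for \<open>m > n\<close>, and the
  partial trace is taken of the zero map.
\<close>

lemma Alt_on_eq_0_if_repeated_index:
  assumes "i < length as" "j < length as" "i \<noteq> j" "J ! i = J ! j"
  shows "Alt_on as J = 0"
proof (cases "length J = length as")
  case True
  let ?m = "length as"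
  let ?t = "Transposition.transpose i j"
  let ?f = "\<lambda>\<sigma>. of_int (sign \<sigma>) * (\<Prod>k<?m. as ! \<sigma> k $ (J ! k))"
  have t: "?t permutes {..<?m}"
    using assms by (intro permutes_swap_id) auto
  have J_t: "J ! ?t k = J ! k" for k
    using assms by (auto simp: Transposition.transpose_def)
  \<comment> \<open>The sign flips, while the product is merely reindexed by \<open>?t\<close>,
    because \<open>J\<close> agrees at \<open>i\<close> and \<open>j\<close>.\<close>
  have swap: "?f (\<sigma> \<circ> ?t) = - ?f \<sigma>" if "\<sigma> permutes {..<?m}" for \<sigma>
  proof -
    have "permutation \<sigma>"
      using that by (auto simp: permutation_permutes)
    then have "sign (\<sigma> \<circ> ?t) = - sign \<sigma>"
      using assms by (simp add: sign_compose permutation_swap_id sign_swap_id)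
    moreover have "(\<Prod>k<?m. as ! \<sigma> (?t k) $ (J ! k)) = (\<Prod>k<?m. as ! \<sigma> k $ (J ! k))"
      using prod.permute[OF t, of "\<lambda>k. as ! \<sigma> k $ (J ! k)"] by (simp add: comp_def J_t)
    ultimately show ?thesis by simp
  qed
  have "sum ?f {\<sigma>. \<sigma> permutes {..<?m}} = (\<Sum>\<sigma> | \<sigma> permutes {..<?m}. ?f (\<sigma> \<circ> ?t))"
    by (rule sum_permutations_compose_right[OF t])
  also have "\<dots> = - sum ?f {\<sigma>. \<sigma> permutes {..<?m}}"
    unfolding sum_negf[symmetric] by (intro sum.cong) (simp_all only: swap mem_Collect_eq)
  finally have "sum ?f {\<sigma>. \<sigma> permutes {..<?m}} = 0"
    by simp
  then show ?thesis
    using True by (simp add: Alt_on_def pure_tensor_def)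
\<comment> \<open>For a multi-index of the wrong length, \<open>pure_tensor\<close> takes its
  default value 0.\<close>
qed (simp add: Alt_on_def pure_tensor_def)

lemma Alt_on_eq_0_if_length_gt:
  fixes as :: "(complex ^ 'n::finite) list"
  assumes "length as > CARD('n)"
  shows "Alt_on as J = 0"
proof -
  \<comment> \<open>Even past the end of \<open>J\<close>, \<open>J ! k\<close> is some element of
    \<open>'n\<close>, so the pigeonhole principle applies whatever the length of
    \<open>J\<close>.\<close>
  have "card ((!) J ` {..<length as}) \<le> CARD('n)"
    by (intro card_mono) auto
  then have "\<not> inj_on ((!) J) {..<length as}"
    using assms by (intro pigeonhole) simp
  then show ?thesis
    by (auto simp: inj_on_def intro: Alt_on_eq_0_if_repeated_index)
qed

text \<open>\<open>lin_ext\<close> combines the images of the basis tensors of length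
  \<open>m\<close>, and each of these images is zero; hence \<open>t\<close> may be any coordinate
  function.\<close>

lemma Alt_eq_0:
  fixes t :: "'n::finite tensor"
  assumes "m > CARD('n)"
  shows "Alt m t J = 0"
  using assms by (simp add: Alt_def lin_ext_def Alt_on_eq_0_if_length_gt)

theorem theorem7p1:
  fixes A :: "complex ^ 'n ^ 'n"
  shows "ptr CARD('n) (Alt (CARD('n) + 1) \<circ> tensor_map (id # replicate CARD('n) ((*v) A))) = (\<lambda>v. 0)"
  by (simp add: ptr_def Alt_eq_0 fun_eq_iff vec_eq_iff)

end
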